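(* The Vaidya-Bonner-de Sitter spacetime with $q^2-rm\neq 0$ is not conformally recurrent, but (i) its conformal curvature $2$-forms are recurrent for the $1$-form with components $\left(\frac{rm'-(q^2)'}{rm-q^2},\ \frac{q^2}{r^2m-rq^2},\ 0,\ 0\right)$ in the coordinates $(t,r,\theta,\phi)$; (ii) the common (general) form of a $(0,2)$ tensor compatible with $C$ is $$\begin{pmatrix}\mathcal H_{11}&\mathcal H_{12}&0&0\\ \mathcal H_{12}&\mathcal H_{22}&0&0\\ 0&0&\mathcal H_{33}&\mathcal H_{34}\\ 0&0&\mathcal H_{34}&\mathcal H_{44}\end{pmatrix},$$ where $\mathcal H_{ij}$ are arbitrary scalars.
   Context: The Vaidya-Bonner-de Sitter (VBdS) spacetime is the $4$-dimensional Lorentzian manifold with coordinates $(x^1,x^2,x^3,x^4)=(t,r,\theta,\phi)$ and metric $ds^2=\left(1-\frac{2m(t)}{r}+\frac{q^2(t)}{r^2}-\frac{\lambda r^2}{3}\right)dt^2-2\,dt\,dr-r^2(d\theta^2+\sin^2\theta\, d\phi^2)$, where $\lambda$ is a constant and the mass $m=m(t)$ and charge $q=q(t)$ are smooth functions depending on $t$; $m'=\frac{dm}{dt}$ and $(q^2)'=\frac{d(q^2)}{dt}$. Curvature conventions: $R_{efst}=g_{e\alpha}(\partial_s\Gamma^\alpha_{ft}-\partial_t\Gamma^\alpha_{fs}+\Gamma^\beta_{ft}\Gamma^\alpha_{\beta s}-\Gamma^\beta_{fs}\Gamma^\alpha_{\beta t})$, $S_{fs}=g^{et}R_{efst}$,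 $\bar\kappa=g^{fs}S_{fs}$. With $(X\wedge Z)_{efst}=X_{et}Z_{fs}+X_{fs}Z_{et}-X_{es}Z_{ft}-X_{ft}Z_{es}$, the Weyl conformal curvature tensor is $C=R-\frac12 g\wedge S+\frac{\bar\kappa}{12}g\wedge g$. The spacetime is conformally recurrent if $\nabla_dC_{efst}=\Pi_dC_{efst}$ for some $1$-form $\Pi$. The conformal curvature $2$-forms are recurrent for a $1$-form $\Pi$ if the cyclic sum over $e,f,s$ of $\nabla_e C_{fstd}$ equals the cyclic sum over $e,f,s$ of $\Pi_e C_{fstd}$. A $(0,2)$ tensor $H$ is compatible with a $(0,4)$ tensor $D$ if the cyclic sum over $e,f,s$ of $H_e{}^d D_{fstd}$ vanishes, with $H_e{}^d=g^{d\alpha}H_{e\alpha}$. *)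

theory Defs
  imports "HOL-Analysis.Analysis"
begin

section \<open>Tensor calculus in a coordinate chart\<close>

text \<open>
  Tensor fields are given by their components in a fixed chart: a metric and other
  (0,2) tensor fields are matrix-valued fields on coordinate space, 1-forms are vector-valued
  fields, and (0,4) tensor fields map a point and four indices to a real.
\<close>

definition partial_deriv :: "'n::finite \<Rightarrow> (real ^ 'n \<Rightarrow> real) \<Rightarrow> real ^ 'n \<Rightarrow> real" where
  "partial_deriv i f x = deriv (\<lambda>h. f (x + h *\<^sub>R axis i 1)) 0"

text \<open>\<open>christoffel g x a b c\<close> has the upper index \<open>a\<close> and the lower indices \<open>b\<close>, \<open>c\<close>.\<close>

definition christoffel ::
  "(real ^ 'n \<Rightarrow> real ^ 'n ^ 'n) \<Rightarrow> real ^ 'n \<Rightarrow> 'n::finite \<Rightarrow> 'n \<Rightarrow> 'n \<Rightarrow> real" where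
  "christoffel g x a b c =
     (1 / 2) * (\<Sum>d\<in>UNIV. matrix_inv (g x) $ a $ d *
       (partial_deriv b (\<lambda>y. g y $ d $ c) x + partial_deriv c (\<lambda>y. g y $ d $ b) x
        - partial_deriv d (\<lambda>y. g y $ b $ c) x))"

definition riemann ::
  "(real ^ 'n \<Rightarrow> real ^ 'n ^ 'n) \<Rightarrow> real ^ 'n \<Rightarrow> 'n::finite \<Rightarrow> 'n \<Rightarrow> 'n \<Rightarrow> 'n \<Rightarrow> real" where
  "riemann g x e f s t =
     (\<Sum>\<alpha>\<in>UNIV. g x $ e $ \<alpha> *
       (partial_deriv s (\<lambda>y. christoffel g y \<alpha> f t) x
        - partial_deriv t (\<lambda>y. christoffel g y \<alpha> f s) x
        + (\<Sum>\<beta>\<in>UNIV. christoffel g x \<beta> f t * christoffel g x \<alpha> \<beta> s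
                      - christoffel g x \<beta> f s * christoffel g x \<alpha> \<beta> t)))"

text \<open>
  Sign convention: the first and the last index are contracted, so this is the negative of the
  contraction of the first and the third index.
\<close>

definition ricci :: "(real ^ 'n \<Rightarrow> real ^ 'n ^ 'n) \<Rightarrow> real ^ 'n \<Rightarrow> real ^ 'n ^ ('n::finite)" where
  "ricci g x = (\<chi> f s. \<Sum>e\<in>UNIV. \<Sum>t\<in>UNIV. matrix_inv (g x) $ e $ t * riemann g x e f s t)"

definition scalar_curvature :: "(real ^ 'n \<Rightarrow> real ^ 'n ^ 'n) \<Rightarrow> real ^ ('n::finite) \<Rightarrow> real" where
  "scalar_curvature g x =
     (\<Sum>f\<in>UNIV. \<Sum>s\<in>UNIV. matrix_inv (g x) $ f $ s * ricci g x $ f $ s)"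

definition kulkarni_nomizu ::
  "real ^ 'n ^ 'n \<Rightarrow> real ^ 'n ^ 'n \<Rightarrow> 'n::finite \<Rightarrow> 'n \<Rightarrow> 'n \<Rightarrow> 'n \<Rightarrow> real" where
  "kulkarni_nomizu X Z e f s t =
     X $ e $ t * Z $ f $ s + X $ f $ s * Z $ e $ t - X $ e $ s * Z $ f $ t - X $ f $ t * Z $ e $ s"

text \<open>The coefficients are those of dimension 4.\<close>

definition weyl :: "(real ^ 4 \<Rightarrow> real ^ 4 ^ 4) \<Rightarrow> real ^ 4 \<Rightarrow> 4 \<Rightarrow> 4 \<Rightarrow> 4 \<Rightarrow> 4 \<Rightarrow> real" where
  "weyl g x e f s t =
     riemann g x e f s t - (1 / 2) * kulkarni_nomizu (g x) (ricci g x) e f s t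
     + (scalar_curvature g x / 12) * kulkarni_nomizu (g x) (g x) e f s t"

text \<open>\<open>cov_deriv g D x d e f s t\<close> is the component \<open>\<nabla>\<^sub>d D\<^sub>e\<^sub>f\<^sub>s\<^sub>t\<close> for the Levi-Civita connection.\<close>

definition cov_deriv ::
  "(real ^ 'n \<Rightarrow> real ^ 'n ^ 'n) \<Rightarrow> (real ^ 'n \<Rightarrow> 'n \<Rightarrow> 'n \<Rightarrow> 'n \<Rightarrow> 'n \<Rightarrow> real) \<Rightarrow>
   real ^ 'n \<Rightarrow> 'n::finite \<Rightarrow> 'n \<Rightarrow> 'n \<Rightarrow> 'n \<Rightarrow> 'n \<Rightarrow> real" where
  "cov_deriv g D x d e f s t =
     partial_deriv d (\<lambda>y. D y e f s t) x
     - (\<Sum>\<alpha>\<in>UNIV. christoffel g x \<alpha> d e * D x \<alpha> f s t + christoffel g x \<alpha> d f * D x e \<alpha> s t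
                   + christoffel g x \<alpha> d s * D x e f \<alpha> t + christoffel g x \<alpha> d t * D x e f s \<alpha>)"

definition cyclic_sum :: "('n \<Rightarrow> 'n \<Rightarrow> 'n \<Rightarrow> real) \<Rightarrow> 'n \<Rightarrow> 'n \<Rightarrow> 'n \<Rightarrow> real" where
  "cyclic_sum T e f s = T e f s + T f s e + T s e f"

section \<open>Recurrence and compatibility\<close>

text \<open>
  No regularity is imposed on the 1-form; where the Weyl tensor of a smooth metric does not
  vanish, the equation already forces the 1-form to be smooth.
\<close>

definition conformally_recurrent_on :: "(real ^ 4 \<Rightarrow> real ^ 4 ^ 4) \<Rightarrow> (real ^ 4) set \<Rightarrow> bool" where
  "conformally_recurrent_on g U \<longleftrightarrow>
     (\<exists>\<omega> :: real ^ 4 \<Rightarrow> real ^ 4. \<forall>x\<in>U. \<forall>d e f s t.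
        cov_deriv g (weyl g) x d e f s t = \<omega> x $ d * weyl g x e f s t)"

definition conformal_2forms_recurrent_on ::
  "(real ^ 4 \<Rightarrow> real ^ 4 ^ 4) \<Rightarrow> (real ^ 4) set \<Rightarrow> (real ^ 4 \<Rightarrow> real ^ 4) \<Rightarrow> bool" where
  "conformal_2forms_recurrent_on g U \<omega> \<longleftrightarrow>
     (\<forall>x\<in>U. \<forall>e f s t d.
        cyclic_sum (\<lambda>e f s. cov_deriv g (weyl g) x e f s t d) e f s =
        cyclic_sum (\<lambda>e f s. \<omega> x $ e * weyl g x f s t d) e f s)"

text \<open>\<open>raise_second g H x e d\<close> is the component \<open>H\<^sub>e\<^sup>d\<close>.\<close>

definition raise_second ::
  "(real ^ 'n \<Rightarrow> real ^ 'n ^ 'n) \<Rightarrow> (real ^ 'n \<Rightarrow> real ^ 'n ^ 'n) \<Rightarrow>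
   real ^ 'n \<Rightarrow> 'n::finite \<Rightarrow> 'n \<Rightarrow> real" where
  "raise_second g H x e d = (\<Sum>\<alpha>\<in>UNIV. matrix_inv (g x) $ d $ \<alpha> * H x $ e $ \<alpha>)"

definition compatible_on ::
  "(real ^ 'n \<Rightarrow> real ^ 'n ^ 'n) \<Rightarrow> (real ^ 'n) set \<Rightarrow> (real ^ 'n \<Rightarrow> real ^ 'n ^ 'n) \<Rightarrow>
   (real ^ 'n \<Rightarrow> 'n::finite \<Rightarrow> 'n \<Rightarrow> 'n \<Rightarrow> 'n \<Rightarrow> real) \<Rightarrow> bool" where
  "compatible_on g U H D \<longleftrightarrow>
     (\<forall>x\<in>U. \<forall>e f s t.
        cyclic_sum (\<lambda>e f s. \<Sum>d\<in>UNIV. raise_second g H x e d * D x f s t d) e f s = 0)"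

section \<open>The Vaidya-Bonner-de Sitter metric\<close>

text \<open>Intended for open \<open>T\<close>, where it says that \<open>f\<close> is infinitely differentiable on \<open>T\<close>.\<close>

definition smooth_real_on :: "(real \<Rightarrow> real) \<Rightarrow> real set \<Rightarrow> bool" where
  "smooth_real_on f T \<longleftrightarrow> (\<forall>n. \<forall>t\<in>T. ((deriv ^^ n) f) differentiable (at t))"

text \<open>
  The coordinates are \<open>x $ 1 = t\<close>, \<open>x $ 2 = r\<close>, \<open>x $ 3 = \<theta>\<close>, \<open>x $ 4 = \<phi>\<close>; the term
  \<open>- 2 dt dr\<close> of the line element gives the two off-diagonal entries \<open>- 1\<close>.
\<close>

definition vbds_metric ::
  "(real \<Rightarrow> real) \<Rightarrow> (real \<Rightarrow> real) \<Rightarrow> real \<Rightarrow> real ^ 4 \<Rightarrow> real ^ 4 ^ 4" where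
  "vbds_metric m q \<Lambda> x =
     (let t = x $ 1; r = x $ 2; \<theta> = x $ 3 in
      vector
       [vector [1 - 2 * m t / r + (q t)\<^sup>2 / r\<^sup>2 - \<Lambda> * r\<^sup>2 / 3, - 1, 0, 0],
        vector [- 1, 0, 0, 0],
        vector [0, 0, - r\<^sup>2, 0],
        vector [0, 0, 0, - (r\<^sup>2 * (sin \<theta>)\<^sup>2)]])"

text \<open>
  The chart of \<open>(t, r, \<theta>, \<phi>)\<close> over the range \<open>T\<close> of the time coordinate, away from the singularity
  \<open>r = 0\<close> and the axis of the spherical coordinates.
\<close>

definition vbds_chart :: "real set \<Rightarrow> (real ^ 4) set" where
  "vbds_chart T = {x. x $ 1 \<in> T \<and> 0 < x $ 2 \<and> 0 < x $ 3 \<and> x $ 3 < pi}"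

end

theory Submission
  imports Defs
begin

text \<open>
  Everything is computed for the metrics \<open>A(t,r) dt\<^sup>2 - 2 dt dr - r\<^sup>2 d\<Omega>\<^sup>2\<close>. Write \<open>g = P + Q\<close> with
  \<open>P\<close> the \<open>(t,r)\<close> block and \<open>Q\<close> the angular block. Such a metric has Weyl tensor
  \<open>C = c K\<close> with \<open>K = P \<and> P + Q \<and> Q - P \<and> Q\<close> and a single function \<open>c(t,r)\<close>, which is
  \<open>(r m - q\<^sup>2) / r\<^sup>4\<close> for the Vaidya-Bonner-de Sitter metric. Moreover
  \<open>\<nabla>\<^sub>d P\<^sub>a\<^sub>b = (Q\<^sub>d\<^sub>a u\<^sub>b + Q\<^sub>d\<^sub>b u\<^sub>a) / r = - \<nabla>\<^sub>d Q\<^sub>a\<^sub>b\<close> with \<open>u = dr\<close>, so that \<open>\<nabla>K\<close> has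
  components where \<open>K\<close> vanishes, while its cyclic sum is that of \<open>(3/r) u K\<close>; hence the
  2-forms are recurrent for \<open>dc/c + (3/r) dr\<close>. Compatibility of \<open>H\<close> becomes the vanishing of the
  cyclic sum of \<open>P\<^sub>e\<^sub>t p\<^sub>f\<^sub>s + Q\<^sub>e\<^sub>t q\<^sub>f\<^sub>s\<close>, where \<open>p\<close> and \<open>q\<close> are the skew parts of two different
  weightings of the columns of \<open>H\<close>.
\<close>

section \<open>Coordinate derivatives and Kulkarni-Nomizu products\<close>

lemma vector_4 [simp]:
  "(vector [a,b,c,d] :: 'a::zero ^ 4) $ 1 = a"
  "(vector [a,b,c,d] :: 'a::zero ^ 4) $ 2 = b"
  "(vector [a,b,c,d] :: 'a::zero ^ 4) $ 3 = c"
  "(vector [a,b,c,d] :: 'a::zero ^ 4) $ 4 = d"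
  unfolding vector_def by simp_all

lemma partial_deriv_eqI:
  assumes "((\<lambda>h. f (x + h *\<^sub>R axis i 1)) has_real_derivative D) (at 0)"
  shows "partial_deriv i f x = D"
  using assms unfolding partial_deriv_def by (rule DERIV_imp_deriv)

lemma partial_deriv_cong:
  assumes "open V" "x \<in> V" "\<And>y. y \<in> V \<Longrightarrow> f y = f' y"
  shows "partial_deriv i f x = partial_deriv i f' x"
proof -
  let ?l = "\<lambda>h. x + h *\<^sub>R axis i (1::real)"
  have "open (?l -` V)"
    using assms(1) by (rule open_vimage) (intro continuous_intros)
  then have "\<forall>\<^sub>F h in nhds 0. ?l h \<in> V"
    using assms(2) by (auto simp: eventually_nhds)
  then have "\<forall>\<^sub>F h in nhds 0. f (?l h) = f' (?l h)"
    by (rule eventually_mono) (use assms(3) in auto)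
  then show ?thesis unfolding partial_deriv_def by (rule deriv_cong_ev) simp
qed

lemma DERIV_at_0:
  fixes f :: "real \<Rightarrow> real"
  assumes "(f has_real_derivative D) (at a)"
  shows "((\<lambda>h. f (a + h)) has_real_derivative D) (at 0)"
  using assms DERIV_shift[of f D 0 a] by (simp add: add.commute)

lemma partial_deriv_const [simp]: "partial_deriv i (\<lambda>y. c) x = 0"
  by (simp add: partial_deriv_def)

lemma matrix_inv_unique:
  fixes M N :: "real ^ 'n ^ 'n"
  assumes "M ** N = mat 1"
  shows "matrix_inv M = N"
proof -
  have "N ** M = mat 1" using assms by (simp add: matrix_left_right_inverse)
  then have "M ** matrix_inv M = mat 1 \<and> matrix_inv M ** M = mat 1"
    using assms someI[of "\<lambda>X. M ** X = mat 1 \<and> X ** M = mat 1" N]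
    unfolding matrix_inv_def by simp
  then have "matrix_inv M = matrix_inv M ** (M ** N)" and "matrix_inv M ** M = mat 1"
    using assms by (simp_all add: matrix_mul_rid)
  then show ?thesis by (simp add: matrix_mul_assoc matrix_mul_lid)
qed

section \<open>The Leibniz rule for Kulkarni-Nomizu products, and cyclic sums of such
  products\<close>

definition cov_deriv2 ::
  "(real ^ 'n \<Rightarrow> real ^ 'n ^ 'n) \<Rightarrow> (real ^ 'n \<Rightarrow> real ^ 'n ^ 'n) \<Rightarrow>
   real ^ 'n \<Rightarrow> 'n::finite \<Rightarrow> real ^ 'n ^ 'n" where
  "cov_deriv2 g X x d = (\<chi> a b. partial_deriv d (\<lambda>y. X y $ a $ b) x
     - (\<Sum>\<alpha>\<in>UNIV. christoffel g x \<alpha> d a * X x $ \<alpha> $ b + christoffel g x \<alpha> d b * X x $ a $ \<alpha>))"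

text \<open>Differentiability along one coordinate line is the right notion here: the metrics below
  come with separate derivatives in t and r, and \<open>partial_deriv\<close> obeys the sum and
  product rules where these line derivatives exist.\<close>

definition partially_differentiable_at :: "'n::finite \<Rightarrow> (real ^ 'n \<Rightarrow> real) \<Rightarrow> real ^ 'n \<Rightarrow> bool" where
  "partially_differentiable_at i f x \<longleftrightarrow> (\<lambda>h. f (x + h *\<^sub>R axis i 1)) differentiable at 0"

lemma partial_deriv_DERIV:
  assumes "partially_differentiable_at i f x"
  shows "((\<lambda>h. f (x + h *\<^sub>R axis i 1)) has_real_derivative partial_deriv i f x) (at 0)"
  using assms unfolding partially_differentiable_at_def partial_deriv_def
  by (simp add: DERIV_deriv_iff_real_differentiable)

lemma partial_deriv_scaled_kulkarni_nomizu:
  assumes c: "partially_differentiable_at d c x"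
    and X: "\<And>a b. partially_differentiable_at d (\<lambda>y. X y $ a $ b) x"
    and Z: "\<And>a b. partially_differentiable_at d (\<lambda>y. Z y $ a $ b) x"
  shows "partial_deriv d (\<lambda>y. c y * kulkarni_nomizu (X y) (Z y) e f s t) x =
    partial_deriv d c x * kulkarni_nomizu (X x) (Z x) e f s t
    + c x * (kulkarni_nomizu (\<chi> a b. partial_deriv d (\<lambda>y. X y $ a $ b) x) (Z x) e f s t
           + kulkarni_nomizu (X x) (\<chi> a b. partial_deriv d (\<lambda>y. Z y $ a $ b) x) e f s t)"
  unfolding kulkarni_nomizu_def
  by (rule partial_deriv_eqI)
     (auto intro!: derivative_eq_intros partial_deriv_DERIV[OF c] partial_deriv_DERIV[OF X]
        partial_deriv_DERIV[OF Z] simp: algebra_simps)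

text \<open>In each of the four terms of the product, two of the slots e, f, s, t belong to X and
  the other two to Z. The four Christoffel corrections therefore split into those of X and those of
  Z.\<close>

lemma cov_deriv_scaled_kulkarni_nomizu:
  assumes c: "partially_differentiable_at d c x"
    and X: "\<And>a b. partially_differentiable_at d (\<lambda>y. X y $ a $ b) x"
    and Z: "\<And>a b. partially_differentiable_at d (\<lambda>y. Z y $ a $ b) x"
  shows "cov_deriv g (\<lambda>y e f s t. c y * kulkarni_nomizu (X y) (Z y) e f s t) x d e f s t =
    partial_deriv d c x * kulkarni_nomizu (X x) (Z x) e f s t
    + c x * (kulkarni_nomizu (cov_deriv2 g X x d) (Z x) e f s t
           + kulkarni_nomizu (X x) (cov_deriv2 g Z x d) e f s t)"
  unfolding cov_deriv_def partial_deriv_scaled_kulkarni_nomizu[OF assms]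
  unfolding kulkarni_nomizu_def cov_deriv2_def
  by (simp add: algebra_simps sum_distrib_left sum_distrib_right sum.distrib sum_subtractf sum_negf)

lemma cov_deriv_cong:
  assumes "open V" "x \<in> V" "\<And>y. y \<in> V \<Longrightarrow> D y = D' y"
  shows "cov_deriv g D x = cov_deriv g D' x"
proof (intro ext)
  fix d e f s t
  have "partial_deriv d (\<lambda>y. D y e f s t) x = partial_deriv d (\<lambda>y. D' y e f s t) x"
    using assms by (intro partial_deriv_cong[of V]) auto
  then show "cov_deriv g D x d e f s t = cov_deriv g D' x d e f s t"
    using assms by (simp add: cov_deriv_def)
qed

text \<open>Terms in which Q carries two of the cycled indices cancel in pairs by symmetry of Q. In
  the remaining terms the index e sits on Q and a cycled index on u; relabelling exchanges them, and
  antisymmetry gives the minus sign.\<close>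

lemma cyclic_sum_kulkarni_nomizu_symmetrized:
  fixes Q M :: "real ^ 'n ^ 'n" and u :: "real ^ 'n"
  assumes "\<And>a b. Q $ a $ b = Q $ b $ a" and "\<And>a b. M $ a $ b = M $ b $ a"
  shows "cyclic_sum (\<lambda>e f s. kulkarni_nomizu (\<chi> a b. Q $ e $ a * u $ b + Q $ e $ b * u $ a) M f s t d) e f s
    = - cyclic_sum (\<lambda>e f s. u $ e * kulkarni_nomizu Q M f s t d) e f s"
  unfolding cyclic_sum_def kulkarni_nomizu_def
  using assms(1)[of f e] assms(1)[of s f] assms(1)[of s e] assms(2)[of f e] assms(2)[of s f] assms(2)[of s e]
  by (simp add: algebra_simps)

text \<open>P lives on the span of w and v, so P \<and> P is a multiple of the square of the 2-form
  built from w and v, and the exterior product of that 2-form with v is zero.\<close>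

lemma cyclic_sum_kulkarni_nomizu_plane:
  fixes P :: "real ^ 'n ^ 'n" and w v :: "real ^ 'n"
  assumes "\<And>a b. P $ a $ b = k * w $ a * w $ b + l * (w $ a * v $ b + v $ a * w $ b)"
  shows "cyclic_sum (\<lambda>e f s. v $ e * kulkarni_nomizu P P f s t d) e f s = 0"
  unfolding cyclic_sum_def kulkarni_nomizu_def assms by (simp add: algebra_simps)

lemma partially_differentiable_add:
  assumes "partially_differentiable_at d f x" "partially_differentiable_at d f' x"
  shows "partially_differentiable_at d (\<lambda>y. f y + f' y) x"
  using assms unfolding partially_differentiable_at_def by (rule differentiable_add)

lemma partially_differentiable_scaled_kulkarni_nomizu:
  assumes "partially_differentiable_at d c x"
    and "\<And>a b. partially_differentiable_at d (\<lambda>y. X y $ a $ b) x"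
    and "\<And>a b. partially_differentiable_at d (\<lambda>y. Z y $ a $ b) x"
  shows "partially_differentiable_at d (\<lambda>y. c y * kulkarni_nomizu (X y) (Z y) e f s t) x"
  using assms unfolding partially_differentiable_at_def kulkarni_nomizu_def
  by (intro derivative_intros)

lemma cov_deriv_add:
  assumes "\<And>e f s t. partially_differentiable_at d (\<lambda>y. D y e f s t) x"
    and "\<And>e f s t. partially_differentiable_at d (\<lambda>y. D' y e f s t) x"
  shows "cov_deriv g (\<lambda>y e f s t. D y e f s t + D' y e f s t) x d e f s t =
    cov_deriv g D x d e f s t + cov_deriv g D' x d e f s t"
proof -
  have "partial_deriv d (\<lambda>y. D y e f s t + D' y e f s t) x =
      partial_deriv d (\<lambda>y. D y e f s t) x + partial_deriv d (\<lambda>y. D' y e f s t) x"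
    by (rule partial_deriv_eqI) (intro derivative_intros partial_deriv_DERIV assms)
  then show ?thesis by (simp add: cov_deriv_def algebra_simps sum.distrib)
qed

lemma partial_deriv_minus:
  assumes "partially_differentiable_at d f x"
  shows "partial_deriv d (\<lambda>y. - f y) x = - partial_deriv d f x"
  by (rule partial_deriv_eqI) (intro derivative_intros partial_deriv_DERIV assms)

section \<open>Spherically symmetric metrics in Eddington-Finkelstein form\<close>

definition ef_metric :: "(real \<Rightarrow> real \<Rightarrow> real) \<Rightarrow> real ^ 4 \<Rightarrow> real ^ 4 ^ 4" where
  "ef_metric A x = vector
     [vector [A (x $ 1) (x $ 2), - 1, 0, 0],
      vector [- 1, 0, 0, 0],
      vector [0, 0, - (x $ 2)\<^sup>2, 0],
      vector [0, 0, 0, - ((x $ 2)\<^sup>2 * (sin (x $ 3))\<^sup>2)]]"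

definition ef_base :: "(real \<Rightarrow> real \<Rightarrow> real) \<Rightarrow> real ^ 4 \<Rightarrow> real ^ 4 ^ 4" where
  "ef_base A x = vector
     [vector [A (x $ 1) (x $ 2), - 1, 0, 0], vector [- 1, 0, 0, 0], 0, 0]"

definition ef_fibre :: "real ^ 4 \<Rightarrow> real ^ 4 ^ 4" where
  "ef_fibre x = vector
     [0, 0, vector [0, 0, - (x $ 2)\<^sup>2, 0],
      vector [0, 0, 0, - ((x $ 2)\<^sup>2 * (sin (x $ 3))\<^sup>2)]]"

definition ef_inverse :: "(real \<Rightarrow> real \<Rightarrow> real) \<Rightarrow> real ^ 4 \<Rightarrow> real ^ 4 ^ 4" where
  "ef_inverse A x = vector
     [vector [0, - 1, 0, 0],
      vector [- 1, - A (x $ 1) (x $ 2), 0, 0],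
      vector [0, 0, - 1 / (x $ 2)\<^sup>2, 0],
      vector [0, 0, 0, - 1 / ((x $ 2)\<^sup>2 * (sin (x $ 3))\<^sup>2)]]"

lemma vbds_chart_nonzero:
  "x \<in> vbds_chart T \<Longrightarrow> x $ 2 \<noteq> 0 \<and> sin (x $ 3) \<noteq> 0"
  using sin_gt_zero by (force simp: vbds_chart_def)

lemma matrix_inv_ef_metric:
  assumes "x \<in> vbds_chart T"
  shows "matrix_inv (ef_metric A x) = ef_inverse A x"
proof (rule matrix_inv_unique)
  show "ef_metric A x ** ef_inverse A x = mat 1"
    using vbds_chart_nonzero[OF assms]
    by (simp add: vec_eq_iff forall_4 matrix_matrix_mult_def sum_4 mat_def
        ef_metric_def ef_inverse_def)
qed

lemma ef_metric_split: "ef_metric A x = ef_base A x + ef_fibre x"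
  by (simp add: vec_eq_iff forall_4 ef_metric_def ef_base_def ef_fibre_def)

text \<open>The derivatives of A are parameters, so that an interpretation supplies closed formulas.
  Using one function in both \<open>A_tr\<close> and \<open>A_rt\<close> encodes the equality of
  mixed partial derivatives.\<close>

locale ef_spacetime =
  fixes T :: "real set" and A A\<^sub>t A\<^sub>r A\<^sub>t\<^sub>r A\<^sub>r\<^sub>r :: "real \<Rightarrow> real \<Rightarrow> real"
  assumes open_T: "open T"
    and A_t: "\<And>t r. t \<in> T \<Longrightarrow> 0 < r \<Longrightarrow> ((\<lambda>s. A s r) has_real_derivative A\<^sub>t t r) (at t)"
    and A_r: "\<And>t r. t \<in> T \<Longrightarrow> 0 < r \<Longrightarrow> (A t has_real_derivative A\<^sub>r t r) (at r)"
    and A_tr: "\<And>t r. t \<in> T \<Longrightarrow> 0 < r \<Longrightarrow> (A\<^sub>t t has_real_derivative A\<^sub>t\<^sub>r t r) (at r)"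
    and A_rt: "\<And>t r. t \<in> T \<Longrightarrow> 0 < r \<Longrightarrow> ((\<lambda>s. A\<^sub>r s r) has_real_derivative A\<^sub>t\<^sub>r t r) (at t)"
    and A_rr: "\<And>t r. t \<in> T \<Longrightarrow> 0 < r \<Longrightarrow> (A\<^sub>r t has_real_derivative A\<^sub>r\<^sub>r t r) (at r)"
begin

abbreviation V where "V \<equiv> vbds_chart T"
abbreviation g where "g \<equiv> ef_metric A"

definition ef_christoffel :: "real ^ 4 \<Rightarrow> real ^ 4 ^ 4 ^ 4" where
  "ef_christoffel y = (let t = y $ 1; r = y $ 2; \<theta> = y $ 3 in vector
    [vector [vector [A\<^sub>r t r / 2, 0, 0, 0],
             0,
             vector [0, 0, - r, 0],
             vector [0, 0, 0, - (r * (sin \<theta>)\<^sup>2)]],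
     vector [vector [(A t r * A\<^sub>r t r - A\<^sub>t t r) / 2, - (A\<^sub>r t r / 2), 0, 0],
             vector [- (A\<^sub>r t r / 2), 0, 0, 0],
             vector [0, 0, - (r * A t r), 0],
             vector [0, 0, 0, - (r * A t r * (sin \<theta>)\<^sup>2)]],
     vector [0,
             vector [0, 0, 1 / r, 0],
             vector [0, 1 / r, 0, 0],
             vector [0, 0, 0, - (sin \<theta> * cos \<theta>)]],
     vector [0,
             vector [0, 0, 0, 1 / r],
             vector [0, 0, 0, cos \<theta> / sin \<theta>],
             vector [0, 1 / r, cos \<theta> / sin \<theta>, 0]]])"

lemma open_V: "open V"
proof -
  have eq: "V = (\<lambda>x. x $ 1) -` T \<inter> {x. 0 < x $ 2} \<inter> {x. 0 < x $ 3} \<inter> {x. x $ 3 < pi}"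
    by (auto simp: vbds_chart_def)
  have "open ((\<lambda>x::real^4. x $ 1) -` T)"
    by (rule open_vimage[OF open_T]) (intro continuous_intros)
  moreover have "open {x::real^4. 0 < x $ 2}" "open {x::real^4. 0 < x $ 3}" "open {x::real^4. x $ 3 < pi}"
    by (intro open_Collect_less continuous_intros)+
  ultimately show ?thesis unfolding eq by (intro open_Int)
qed

section \<open>Connection coefficients\<close>

context
  fixes x :: "real ^ 4"
  assumes xV: "x \<in> V"
begin

lemma in_range: "x $ 1 \<in> T" "0 < x $ 2"
  using xV by (auto simp: vbds_chart_def)

lemma r_nonzero: "x $ 2 \<noteq> 0" and sin_nonzero: "sin (x $ 3) \<noteq> 0"
  using vbds_chart_nonzero[OF xV] by auto

lemmas shifted_derivatives =
  A_t[OF in_range, THEN DERIV_at_0] A_r[OF in_range, THEN DERIV_at_0]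
  A_tr[OF in_range, THEN DERIV_at_0] A_rt[OF in_range, THEN DERIV_at_0]
  A_rr[OF in_range, THEN DERIV_at_0]

lemma partial_deriv_ef:
  "partial_deriv i (\<lambda>y. A (y $ 1) (y $ 2)) x =
    vector [A\<^sub>t (x $ 1) (x $ 2), A\<^sub>r (x $ 1) (x $ 2), 0, 0] $ i"
  "partial_deriv i (\<lambda>y. - (y $ 2)\<^sup>2) x = vector [0, - 2 * x $ 2, 0, 0] $ i"
  "partial_deriv i (\<lambda>y. - ((y $ 2)\<^sup>2 * (sin (y $ 3))\<^sup>2)) x =
    vector [0, - (2 * x $ 2 * (sin (x $ 3))\<^sup>2), - (2 * (x $ 2)\<^sup>2 * sin (x $ 3) * cos (x $ 3)), 0] $ i"
  by (rule partial_deriv_eqI; insert exhaust_4[of i]; elim disjE;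
      simp add: axis_def shifted_derivatives; auto intro!: derivative_eq_intros)+

lemma christoffel_ef: "christoffel g x a b c = ef_christoffel x $ a $ b $ c"
proof -
  have dg: "partial_deriv i (\<lambda>y. g y $ a $ b) x =
    vector [
      vector [vector [A\<^sub>t (x $ 1) (x $ 2), 0, 0, 0], 0, 0, 0],
      vector [vector [A\<^sub>r (x $ 1) (x $ 2), 0, 0, 0], 0, vector [0, 0, - 2 * x $ 2, 0],
              vector [0, 0, 0, - (2 * x $ 2 * (sin (x $ 3))\<^sup>2)]],
      vector [0, 0, 0, vector [0, 0, 0, - (2 * (x $ 2)\<^sup>2 * sin (x $ 3) * cos (x $ 3))]],
      0] $ i $ a $ b" for i a b
    using exhaust_4[of i] exhaust_4[of a] exhaust_4[of b]
    by (elim disjE; simp add: ef_metric_def partial_deriv_ef)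
  show ?thesis
    using exhaust_4[of a] exhaust_4[of b] exhaust_4[of c] r_nonzero sin_nonzero
    unfolding christoffel_def sum_4 matrix_inv_ef_metric[OF xV] dg
    by (elim disjE; simp add: ef_inverse_def ef_christoffel_def Let_def field_simps power2_eq_square)
qed

text \<open>
  The \<open>t\<close>-derivative of \<open>\<Gamma>\<^sup>2\<^sub>1\<^sub>1\<close> involves \<open>A\<^sub>t\<^sub>t\<close> and is left out: it only occurs in Riemann components
  with \<open>s = t = 1\<close>, where it cancels.
\<close>

lemma partial_deriv_ef_christoffel:
  "partial_deriv i (\<lambda>y. A\<^sub>r (y $ 1) (y $ 2) / 2) x =
    vector [A\<^sub>t\<^sub>r (x $ 1) (x $ 2) / 2, A\<^sub>r\<^sub>r (x $ 1) (x $ 2) / 2, 0, 0] $ i"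
  "partial_deriv i (\<lambda>y. - (A\<^sub>r (y $ 1) (y $ 2) / 2)) x =
    vector [- (A\<^sub>t\<^sub>r (x $ 1) (x $ 2) / 2), - (A\<^sub>r\<^sub>r (x $ 1) (x $ 2) / 2), 0, 0] $ i"
  "i \<noteq> 1 \<Longrightarrow>
    partial_deriv i (\<lambda>y. (A (y $ 1) (y $ 2) * A\<^sub>r (y $ 1) (y $ 2) - A\<^sub>t (y $ 1) (y $ 2)) / 2) x =
    vector [0, ((A\<^sub>r (x $ 1) (x $ 2))\<^sup>2 + A (x $ 1) (x $ 2) * A\<^sub>r\<^sub>r (x $ 1) (x $ 2)
      - A\<^sub>t\<^sub>r (x $ 1) (x $ 2)) / 2, 0, 0] $ i"
  "partial_deriv i (\<lambda>y. - y $ 2) x = vector [0, - 1, 0, 0] $ i"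
  "partial_deriv i (\<lambda>y. - (y $ 2 * (sin (y $ 3))\<^sup>2)) x =
    vector [0, - (sin (x $ 3))\<^sup>2, - (2 * x $ 2 * sin (x $ 3) * cos (x $ 3)), 0] $ i"
  "partial_deriv i (\<lambda>y. - (y $ 2 * A (y $ 1) (y $ 2))) x =
    vector [- (x $ 2 * A\<^sub>t (x $ 1) (x $ 2)),
      - (A (x $ 1) (x $ 2) + x $ 2 * A\<^sub>r (x $ 1) (x $ 2)), 0, 0] $ i"
  "partial_deriv i (\<lambda>y. - (y $ 2 * A (y $ 1) (y $ 2) * (sin (y $ 3))\<^sup>2)) x =
    vector [- (x $ 2 * A\<^sub>t (x $ 1) (x $ 2) * (sin (x $ 3))\<^sup>2),
      - ((A (x $ 1) (x $ 2) + x $ 2 * A\<^sub>r (x $ 1) (x $ 2)) * (sin (x $ 3))\<^sup>2),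
      - (2 * x $ 2 * A (x $ 1) (x $ 2) * sin (x $ 3) * cos (x $ 3)), 0] $ i"
  "partial_deriv i (\<lambda>y. 1 / y $ 2) x = vector [0, - 1 / (x $ 2)\<^sup>2, 0, 0] $ i"
  "partial_deriv i (\<lambda>y. - (sin (y $ 3) * cos (y $ 3))) x =
    vector [0, 0, (sin (x $ 3))\<^sup>2 - (cos (x $ 3))\<^sup>2, 0] $ i"
  "partial_deriv i (\<lambda>y. cos (y $ 3) / sin (y $ 3)) x =
    vector [0, 0, - 1 - (cos (x $ 3))\<^sup>2 / (sin (x $ 3))\<^sup>2, 0] $ i"
  by (rule partial_deriv_eqI; insert exhaust_4[of i]; elim disjE;
      simp add: axis_def shifted_derivatives;
      auto intro!: derivative_eq_intros shifted_derivatives simp: r_nonzero sin_nonzero;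
      simp add: r_nonzero sin_nonzero power2_eq_square field_simps)+

end

section \<open>Riemann, Ricci and Weyl tensors\<close>

lemma partial_deriv_christoffel:
  assumes "x \<in> V"
  shows "partial_deriv i (\<lambda>y. christoffel g y a b c) x = partial_deriv i (\<lambda>y. ef_christoffel y $ a $ b $ c) x"
  using open_V assms by (rule partial_deriv_cong) (rule christoffel_ef)

text \<open>This is the Hessian of the function r on the (t,r) block, divided by r: its entries are
  \<open>- \<Gamma>\<^sup>2\<^sub>a\<^sub>b / r\<close>. In a warped product it carries the
  curvature mixing base and fibre.\<close>

definition ef_mixed :: "real ^ 4 \<Rightarrow> real ^ 4 ^ 4" where
  "ef_mixed x = (let t = x $ 1; r = x $ 2 in vector
     [vector [(A\<^sub>t t r - A t r * A\<^sub>r t r) / (2 * r), A\<^sub>r t r / (2 * r), 0, 0],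
      vector [A\<^sub>r t r / (2 * r), 0, 0, 0], 0, 0])"

lemma ef_christoffel_rows:
  "ef_christoffel y $ 1 $ 1 = vector [A\<^sub>r (y $ 1) (y $ 2) / 2, 0, 0, 0]"
  "ef_christoffel y $ 1 $ 2 = 0"
  "ef_christoffel y $ 1 $ 3 = vector [0, 0, - y $ 2, 0]"
  "ef_christoffel y $ 1 $ 4 = vector [0, 0, 0, - (y $ 2 * (sin (y $ 3))\<^sup>2)]"
  "ef_christoffel y $ 2 $ 1 = vector [(A (y $ 1) (y $ 2) * A\<^sub>r (y $ 1) (y $ 2) - A\<^sub>t (y $ 1) (y $ 2)) / 2,
     - (A\<^sub>r (y $ 1) (y $ 2) / 2), 0, 0]"
  "ef_christoffel y $ 2 $ 2 = vector [- (A\<^sub>r (y $ 1) (y $ 2) / 2), 0, 0, 0]"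
  "ef_christoffel y $ 2 $ 3 = vector [0, 0, - (y $ 2 * A (y $ 1) (y $ 2)), 0]"
  "ef_christoffel y $ 2 $ 4 = vector [0, 0, 0, - (y $ 2 * A (y $ 1) (y $ 2) * (sin (y $ 3))\<^sup>2)]"
  "ef_christoffel y $ 3 $ 1 = 0"
  "ef_christoffel y $ 3 $ 2 = vector [0, 0, 1 / y $ 2, 0]"
  "ef_christoffel y $ 3 $ 3 = vector [0, 1 / y $ 2, 0, 0]"
  "ef_christoffel y $ 3 $ 4 = vector [0, 0, 0, - (sin (y $ 3) * cos (y $ 3))]"
  "ef_christoffel y $ 4 $ 1 = 0"
  "ef_christoffel y $ 4 $ 2 = vector [0, 0, 0, 1 / y $ 2]"
  "ef_christoffel y $ 4 $ 3 = vector [0, 0, 0, cos (y $ 3) / sin (y $ 3)]"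
  "ef_christoffel y $ 4 $ 4 = vector [0, 1 / y $ 2, cos (y $ 3) / sin (y $ 3), 0]"
  by (simp_all add: ef_christoffel_def Let_def)

lemma block_rows:
  "g y $ 1 = vector [A (y $ 1) (y $ 2), - 1, 0, 0]"
  "g y $ 2 = vector [- 1, 0, 0, 0]"
  "g y $ 3 = vector [0, 0, - (y $ 2)\<^sup>2, 0]"
  "g y $ 4 = vector [0, 0, 0, - ((y $ 2)\<^sup>2 * (sin (y $ 3))\<^sup>2)]"
  "ef_base A y $ 1 = vector [A (y $ 1) (y $ 2), - 1, 0, 0]"
  "ef_base A y $ 2 = vector [- 1, 0, 0, 0]"
  "ef_base A y $ 3 = 0"
  "ef_base A y $ 4 = 0"
  "ef_fibre y $ 1 = 0"
  "ef_fibre y $ 2 = 0"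
  "ef_fibre y $ 3 = vector [0, 0, - (y $ 2)\<^sup>2, 0]"
  "ef_fibre y $ 4 = vector [0, 0, 0, - ((y $ 2)\<^sup>2 * (sin (y $ 3))\<^sup>2)]"
  "ef_mixed y $ 1 = vector [(A\<^sub>t (y $ 1) (y $ 2) - A (y $ 1) (y $ 2) * A\<^sub>r (y $ 1) (y $ 2)) / (2 * y $ 2),
     A\<^sub>r (y $ 1) (y $ 2) / (2 * y $ 2), 0, 0]"
  "ef_mixed y $ 2 = vector [A\<^sub>r (y $ 1) (y $ 2) / (2 * y $ 2), 0, 0, 0]"
  "ef_mixed y $ 3 = 0"
  "ef_mixed y $ 4 = 0"
  by (simp_all add: ef_metric_def ef_base_def ef_fibre_def ef_mixed_def Let_def)

text \<open>The warped product decomposition: intrinsic curvature of the (t,r) surface, curvature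
  1/r^2 of the spheres corrected by the gradient term A/r^2, and the mixed part given by the Hessian
  of r.\<close>

lemma riemann_ef:
  assumes xV: "x \<in> V"
  shows "riemann g x e f s t =
    - (A\<^sub>r\<^sub>r (x $ 1) (x $ 2) / 4) * kulkarni_nomizu (ef_base A x) (ef_base A x) e f s t
    + (1 - A (x $ 1) (x $ 2)) / (2 * (x $ 2)\<^sup>2) * kulkarni_nomizu (ef_fibre x) (ef_fibre x) e f s t
    + kulkarni_nomizu (ef_mixed x) (ef_fibre x) e f s t"
proof -
  have cc: "cos (x $ 3) * cos (x $ 3) = 1 - sin (x $ 3) * sin (x $ 3)"
    using cos_squared_eq[of "x $ 3"] by (simp add: power2_eq_square)
  \<comment> \<open>Products are normalised with nesting to the right, so a squared cosine also
    occurs in front of a further factor z.\<close>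
  have ccz: "cos (x $ 3) * (cos (x $ 3) * z) = z - sin (x $ 3) * (sin (x $ 3) * z)" for z
    unfolding mult.assoc[symmetric] cc by (simp add: left_diff_distrib)
  show ?thesis
    using exhaust_4[of e] exhaust_4[of f] exhaust_4[of s] exhaust_4[of t]
      r_nonzero[OF xV] sin_nonzero[OF xV]
    unfolding riemann_def sum_4 christoffel_ef[OF xV] partial_deriv_christoffel[OF xV]
      kulkarni_nomizu_def
    by (elim disjE; hypsubst; (simp only: ef_christoffel_rows block_rows vector_4 zero_index)?;
        (simp add: partial_deriv_ef_christoffel[OF xV])?;
        (simp add: field_simps power2_eq_square power4_eq_xxxx cc ccz)?)
qed

lemma inverse_rows:
  "ef_inverse A y $ 1 = vector [0, - 1, 0, 0]"
  "ef_inverse A y $ 2 = vector [- 1, - A (y $ 1) (y $ 2), 0, 0]"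
  "ef_inverse A y $ 3 = vector [0, 0, - 1 / (y $ 2)\<^sup>2, 0]"
  "ef_inverse A y $ 4 = vector [0, 0, 0, - 1 / ((y $ 2)\<^sup>2 * (sin (y $ 3))\<^sup>2)]"
  by (simp_all add: ef_inverse_def)

definition weyl_factor :: "real \<Rightarrow> real \<Rightarrow> real" where
  "weyl_factor t r = (2 - 2 * A t r + 2 * r * A\<^sub>r t r - r\<^sup>2 * A\<^sub>r\<^sub>r t r) / (12 * r\<^sup>2)"

context
  fixes x :: "real ^ 4"
  assumes xV: "x \<in> V"
begin

text \<open>Each block has trace 2, so P \<and> P and Q \<and> Q contract to 2 P and 2 Q. With N =
  \<open>ef_mixed x\<close>, the product N \<and> Q contracts to (tr N) Q + 2 N, where tr N is
  \<open>- A\<^sub>r / r\<close>.\<close>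

lemma ricci_ef:
  "ricci g x = (- A\<^sub>r\<^sub>r (x $ 1) (x $ 2) / 2) *\<^sub>R ef_base A x
    + ((1 - A (x $ 1) (x $ 2)) / (x $ 2)\<^sup>2 - A\<^sub>r (x $ 1) (x $ 2) / x $ 2) *\<^sub>R ef_fibre x
    + 2 *\<^sub>R ef_mixed x"
proof -
  have "ricci g x $ f $ s = ((- A\<^sub>r\<^sub>r (x $ 1) (x $ 2) / 2) *\<^sub>R ef_base A x
    + ((1 - A (x $ 1) (x $ 2)) / (x $ 2)\<^sup>2 - A\<^sub>r (x $ 1) (x $ 2) / x $ 2) *\<^sub>R ef_fibre x
    + 2 *\<^sub>R ef_mixed x) $ f $ s" for f s
    using exhaust_4[of f] exhaust_4[of s] r_nonzero[OF xV] sin_nonzero[OF xV]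
    unfolding ricci_def riemann_ef[OF xV] matrix_inv_ef_metric[OF xV] sum_4 kulkarni_nomizu_def
    by (elim disjE; hypsubst; simp add: block_rows inverse_rows;
        (simp add: field_simps power2_eq_square)?)
  then show ?thesis by (simp add: vec_eq_iff)
qed

lemma scalar_curvature_ef:
  "scalar_curvature g x = - A\<^sub>r\<^sub>r (x $ 1) (x $ 2)
    + 2 * (1 - A (x $ 1) (x $ 2)) / (x $ 2)\<^sup>2 - 4 * A\<^sub>r (x $ 1) (x $ 2) / x $ 2"
  using r_nonzero[OF xV] sin_nonzero[OF xV]
  unfolding scalar_curvature_def ricci_ef matrix_inv_ef_metric[OF xV] sum_4
  by (simp add: block_rows inverse_rows; simp add: field_simps power2_eq_square)

text \<open>
  In the plane, \<open>N \<and> P = (tr N / 2) P \<and> P\<close> for every symmetric \<open>N\<close>.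
\<close>

lemma ef_mixed_base:
  "kulkarni_nomizu (ef_mixed x) (ef_base A x) e f s t =
    - (A\<^sub>r (x $ 1) (x $ 2) / (2 * x $ 2)) * kulkarni_nomizu (ef_base A x) (ef_base A x) e f s t"
  using exhaust_4[of e] exhaust_4[of f] exhaust_4[of s] exhaust_4[of t] r_nonzero[OF xV]
  unfolding kulkarni_nomizu_def
  by (elim disjE; hypsubst; simp add: block_rows; (simp add: field_simps)?)

text \<open>The N \<and> Q term of the curvature cancels against that of the Ricci part, and N
  \<and> P reduces to P \<and> P by \<open>ef_mixed_base\<close>. The three coefficients that are
  left agree up to sign.\<close>

lemma weyl_ef:
  "weyl g x e f s t = weyl_factor (x $ 1) (x $ 2) * (kulkarni_nomizu (ef_base A x) (ef_base A x) e f s t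
    + kulkarni_nomizu (ef_fibre x) (ef_fibre x) e f s t
    - kulkarni_nomizu (ef_base A x) (ef_fibre x) e f s t)"
proof -
  define P Q N where "P = ef_base A x" and "Q = ef_fibre x" and "N = ef_mixed x"
  define a b k where "a = A\<^sub>r\<^sub>r (x $ 1) (x $ 2)" and "b = (1 - A (x $ 1) (x $ 2)) / (x $ 2)\<^sup>2"
    and "k = A\<^sub>r (x $ 1) (x $ 2) / x $ 2"
  have c: "weyl_factor (x $ 1) (x $ 2) = b / 6 + k / 6 - a / 12"
    using r_nonzero[OF xV]
    by (simp add: weyl_factor_def a_def b_def k_def field_simps power2_eq_square)
  have NP: "kulkarni_nomizu N P e f s t = - (k / 2) * kulkarni_nomizu P P e f s t"
    using ef_mixed_base[of e f s t] by (simp add: N_def P_def k_def)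
  have "weyl g x e f s t = - (a / 4) * kulkarni_nomizu P P e f s t
    + b / 2 * kulkarni_nomizu Q Q e f s t + kulkarni_nomizu N Q e f s t
    - (1 / 2) * kulkarni_nomizu (P + Q) ((- a / 2) *\<^sub>R P + (b - k) *\<^sub>R Q + 2 *\<^sub>R N) e f s t
    + (- a + 2 * b - 4 * k) / 12 * kulkarni_nomizu (P + Q) (P + Q) e f s t"
    unfolding weyl_def riemann_ef[OF xV] ricci_ef scalar_curvature_ef
    by (simp add: ef_metric_split P_def Q_def N_def a_def b_def k_def)
  also have "\<dots> = - (a / 4) * kulkarni_nomizu P P e f s t
    + b / 2 * kulkarni_nomizu Q Q e f s t
    - (1 / 2) * ((- a / 2) * kulkarni_nomizu P P e f s t + (b - k) * kulkarni_nomizu Q Q e f s t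
        + ((- a / 2) + (b - k)) * kulkarni_nomizu P Q e f s t + 2 * kulkarni_nomizu N P e f s t)
    + (- a + 2 * b - 4 * k) / 12 * (kulkarni_nomizu P P e f s t + kulkarni_nomizu Q Q e f s t
        + 2 * kulkarni_nomizu P Q e f s t)"
    unfolding kulkarni_nomizu_def by (simp add: field_simps)
  also have "\<dots> = (b / 6 + k / 6 - a / 12) * (kulkarni_nomizu P P e f s t
    + kulkarni_nomizu Q Q e f s t - kulkarni_nomizu P Q e f s t)"
    unfolding NP by (simp add: field_simps)
  finally show ?thesis unfolding c P_def Q_def .
qed

end

section \<open>Covariant derivative of the Weyl tensor, and recurrence\<close>

context
  fixes x :: "real ^ 4"
  assumes xV: "x \<in> V"
begin

text \<open>Up to the factor 1/r this is the derivative of P in direction d; \<open>axis 2 1\<close>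
  is the 1-form dr. It vanishes for d = 1, 2: the splitting into blocks is parallel along t and r
  and turns only along the spheres.\<close>

definition drift :: "4 \<Rightarrow> real ^ 4 ^ 4" where
  "drift d = (\<chi> a b. (ef_fibre x $ d $ a * axis 2 1 $ b + ef_fibre x $ d $ b * axis 2 1 $ a))"

lemma partially_differentiable_blocks:
  "partially_differentiable_at i (\<lambda>y. ef_base A y $ a $ b) x"
  "partially_differentiable_at i (\<lambda>y. ef_fibre y $ a $ b) x"
proof -
  have A: "partially_differentiable_at i (\<lambda>y. A (y $ 1) (y $ 2)) x"
    using exhaust_4[of i] shifted_derivatives(1,2)[OF xV]
    unfolding partially_differentiable_at_def real_differentiable_def
    by (elim disjE) (auto simp: axis_def intro: DERIV_const)
  have r: "partially_differentiable_at i (\<lambda>y. - (y $ 2)\<^sup>2) x"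
    and sin: "partially_differentiable_at i (\<lambda>y. - ((y $ 2)\<^sup>2 * (sin (y $ 3))\<^sup>2)) x"
    unfolding partially_differentiable_at_def real_differentiable_def
    by (simp, rule exI, (rule derivative_eq_intros refl)+)+
  have const: "partially_differentiable_at i (\<lambda>y. k) x" for k
    by (simp add: partially_differentiable_at_def)
  show "partially_differentiable_at i (\<lambda>y. ef_base A y $ a $ b) x"
    using exhaust_4[of a] exhaust_4[of b] A
    by (elim disjE; hypsubst; simp add: block_rows const)
  show "partially_differentiable_at i (\<lambda>y. ef_fibre y $ a $ b) x"
    using exhaust_4[of a] exhaust_4[of b] r sin
    by (elim disjE; hypsubst; simp add: block_rows const)
qed

lemma cov_deriv2_base: "cov_deriv2 g (ef_base A) x d = (1 / x $ 2) *\<^sub>R drift d"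
proof -
  have "cov_deriv2 g (ef_base A) x d $ a $ b = ((1 / x $ 2) *\<^sub>R drift d) $ a $ b" for a b
    using exhaust_4[of a] exhaust_4[of b] exhaust_4[of d] r_nonzero[OF xV] sin_nonzero[OF xV]
    unfolding cov_deriv2_def drift_def christoffel_ef[OF xV] sum_4
    by (elim disjE; hypsubst; simp add: block_rows ef_christoffel_rows axis_def partial_deriv_ef[OF xV];
        (simp add: field_simps power2_eq_square)?)
  then show ?thesis by (simp add: vec_eq_iff)
qed

text \<open>The sign is opposite to that of \<open>cov_deriv2_base\<close>, as it must be because P
  + Q = g is parallel.\<close>

lemma cov_deriv2_fibre: "cov_deriv2 g ef_fibre x d = - (1 / x $ 2) *\<^sub>R drift d"
proof -
  have "cov_deriv2 g ef_fibre x d $ a $ b = (- (1 / x $ 2) *\<^sub>R drift d) $ a $ b" for a b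
    using exhaust_4[of a] exhaust_4[of b] exhaust_4[of d] r_nonzero[OF xV] sin_nonzero[OF xV]
    unfolding cov_deriv2_def drift_def christoffel_ef[OF xV] sum_4
    by (elim disjE; hypsubst; simp add: block_rows ef_christoffel_rows axis_def partial_deriv_ef[OF xV];
        (simp add: field_simps power2_eq_square)?)
  then show ?thesis by (simp add: vec_eq_iff)
qed

text \<open>Write D for \<open>drift d\<close> divided by r. The derivatives of P \<and> P, Q \<and>
  Q and - P \<and> Q are 2 D \<and> P, - 2 D \<and> Q and D \<and> P - D \<and> Q; the sum is 3 D
  \<and> (P - Q).\<close>

lemma cov_deriv_weyl_ef:
  assumes dc: "partially_differentiable_at d (\<lambda>y. weyl_factor (y $ 1) (y $ 2)) x"
  shows "cov_deriv g (weyl g) x d e f s t =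
    partial_deriv d (\<lambda>y. weyl_factor (y $ 1) (y $ 2)) x *
      (kulkarni_nomizu (ef_base A x) (ef_base A x) e f s t
        + kulkarni_nomizu (ef_fibre x) (ef_fibre x) e f s t
        - kulkarni_nomizu (ef_base A x) (ef_fibre x) e f s t)
    + weyl_factor (x $ 1) (x $ 2) * (3 / x $ 2) *
      kulkarni_nomizu (drift d) (ef_base A x - ef_fibre x) e f s t"
proof -
  let ?P = "ef_base A" and ?Q = ef_fibre and ?c = "\<lambda>y. weyl_factor (y $ 1) (y $ 2)"
  let ?S = "\<lambda>c X Z y e f s t. c y * kulkarni_nomizu (X y) (Z y) e f s t"
  define k where "k = 1 / x $ 2"
  have k3: "3 / x $ 2 = 3 * k" by (simp add: k_def)
  have dmc: "partially_differentiable_at d (\<lambda>y. - ?c y) x"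
    using dc unfolding partially_differentiable_at_def by (rule differentiable_minus)
  \<comment> \<open>The minus sign of P \<and> Q goes into the scalar, so that all three summands
    are scaled products as in the Leibniz rule.\<close>
  have "cov_deriv g (weyl g) x d e f s t =
      cov_deriv g (\<lambda>y e f s t. (?S ?c ?P ?P y e f s t + ?S ?c ?Q ?Q y e f s t)
        + ?S (\<lambda>y. - ?c y) ?P ?Q y e f s t) x d e f s t"
    by (subst cov_deriv_cong[OF open_V xV]) (auto simp: fun_eq_iff weyl_ef algebra_simps)
  also have "\<dots> = cov_deriv g (?S ?c ?P ?P) x d e f s t + cov_deriv g (?S ?c ?Q ?Q) x d e f s t
      + cov_deriv g (?S (\<lambda>y. - ?c y) ?P ?Q) x d e f s t"
    by (subst cov_deriv_add | intro partially_differentiable_add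
        partially_differentiable_scaled_kulkarni_nomizu dc dmc partially_differentiable_blocks
        refl)+
  also have "\<dots> = partial_deriv d ?c x *
      (kulkarni_nomizu (?P x) (?P x) e f s t + kulkarni_nomizu (?Q x) (?Q x) e f s t
        - kulkarni_nomizu (?P x) (?Q x) e f s t)
    + ?c x * (3 / x $ 2) * kulkarni_nomizu (drift d) (?P x - ?Q x) e f s t"
    unfolding cov_deriv_scaled_kulkarni_nomizu[OF dc partially_differentiable_blocks(1) partially_differentiable_blocks(1)]
      cov_deriv_scaled_kulkarni_nomizu[OF dc partially_differentiable_blocks(2) partially_differentiable_blocks(2)]
      cov_deriv_scaled_kulkarni_nomizu[OF dmc partially_differentiable_blocks(1) partially_differentiable_blocks(2)]
      partial_deriv_minus[OF dc] cov_deriv2_base cov_deriv2_fibre k_def[symmetric] k3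
    unfolding kulkarni_nomizu_def by (simp add: algebra_simps)
  finally show ?thesis .
qed

text \<open>The condition on \<omega> is the equation \<omega> = dc/c + (3/r) dr multiplied by c,
  which avoids a division.\<close>

lemma cyclic_sum_cov_deriv_weyl_ef:
  assumes dc: "\<And>i. partially_differentiable_at i (\<lambda>y. weyl_factor (y $ 1) (y $ 2)) x"
    and \<omega>: "\<And>i. weyl_factor (x $ 1) (x $ 2) * \<omega> $ i =
      partial_deriv i (\<lambda>y. weyl_factor (y $ 1) (y $ 2)) x
        + weyl_factor (x $ 1) (x $ 2) * (3 / x $ 2) * axis 2 1 $ i"
  shows "cyclic_sum (\<lambda>e f s. cov_deriv g (weyl g) x e f s t d) e f s =
    cyclic_sum (\<lambda>e f s. \<omega> $ e * weyl g x f s t d) e f s"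
proof -
  define P Q and u :: "real ^ 4" where "P = ef_base A x" and "Q = ef_fibre x" and "u = axis 2 1"
  define c where "c = weyl_factor (x $ 1) (x $ 2)"
  define K where "K f s = kulkarni_nomizu P P f s t d + kulkarni_nomizu Q Q f s t d
    - kulkarni_nomizu P Q f s t d" for f s
  \<comment> \<open>P = A dt dt - (dt dr + dr dt) has the shape required by
    \<open>cyclic_sum_kulkarni_nomizu_plane\<close>, with w = dt and v = dr.\<close>
  have P: "P $ a $ b = A (x $ 1) (x $ 2) * axis 1 1 $ a * axis 1 1 $ b
      + (- 1) * (axis 1 1 $ a * u $ b + u $ a * axis 1 1 $ b)" for a b
    using exhaust_4[of a] exhaust_4[of b]
    by (elim disjE; hypsubst; simp add: P_def u_def block_rows axis_def)
  have symP: "P $ a $ b = P $ b $ a" for a b by (simp add: P)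
  have symQ: "Q $ a $ b = Q $ b $ a" for a b
    using exhaust_4[of a] exhaust_4[of b]
    by (elim disjE; hypsubst; simp add: Q_def block_rows)
  have "cyclic_sum (\<lambda>e f s. kulkarni_nomizu (drift e) (P - Q) f s t d) e f s =
      - cyclic_sum (\<lambda>e f s. u $ e * kulkarni_nomizu Q (P - Q) f s t d) e f s"
    using cyclic_sum_kulkarni_nomizu_symmetrized[of Q "P - Q" u t d e f s] symP symQ
    by (simp add: drift_def[folded Q_def u_def])
  \<comment> \<open>This is - Q \<and> (P - Q) = K - P \<and> P; the P \<and> P part then drops out,
    since u lies in the plane of P.\<close>
  also have "\<dots> = cyclic_sum (\<lambda>e f s. u $ e * K f s) e f s
      - cyclic_sum (\<lambda>e f s. u $ e * kulkarni_nomizu P P f s t d) e f s"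
    by (simp add: cyclic_sum_def K_def kulkarni_nomizu_def algebra_simps)
  also have "\<dots> = cyclic_sum (\<lambda>e f s. u $ e * K f s) e f s"
    by (simp add: cyclic_sum_kulkarni_nomizu_plane[OF P])
  finally have drift: "cyclic_sum (\<lambda>e f s. kulkarni_nomizu (drift e) (P - Q) f s t d) e f s =
    cyclic_sum (\<lambda>e f s. u $ e * K f s) e f s" .
  have "cyclic_sum (\<lambda>e f s. cov_deriv g (weyl g) x e f s t d) e f s =
      cyclic_sum (\<lambda>e f s. partial_deriv e (\<lambda>y. weyl_factor (y $ 1) (y $ 2)) x * K f s) e f s
      + c * (3 / x $ 2) * cyclic_sum (\<lambda>e f s. kulkarni_nomizu (drift e) (P - Q) f s t d) e f s"
    unfolding cov_deriv_weyl_ef[OF dc] P_def[symmetric] Q_def[symmetric] c_def[symmetric]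
      K_def[symmetric]
    by (simp add: cyclic_sum_def distrib_left)
  also have "\<dots> = cyclic_sum (\<lambda>e f s. c * \<omega> $ e * K f s) e f s"
    unfolding drift \<omega>[folded c_def u_def]
    by (simp add: cyclic_sum_def algebra_simps)
  also have "\<dots> = cyclic_sum (\<lambda>e f s. \<omega> $ e * weyl g x f s t d) e f s"
    unfolding weyl_ef[OF xV] P_def[symmetric] Q_def[symmetric] c_def[symmetric] K_def[symmetric]
    by (simp add: mult_ac)
  finally show ?thesis .
qed

text \<open>In this component the only surviving term of the derivative is \<open>drift 3\<close> at
  (3,2) times - Q at (4,4). It equals -(3c/r) times the product of the two nonzero angular entries
  of Q, whereas recurrence would make it a multiple of 0.\<close>

lemma not_recurrent_at_ef:
  assumes dc: "partially_differentiable_at 3 (\<lambda>y. weyl_factor (y $ 1) (y $ 2)) x"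
    and c: "weyl_factor (x $ 1) (x $ 2) \<noteq> 0"
  shows "weyl g x 3 4 4 2 = 0" and "cov_deriv g (weyl g) x 3 3 4 4 2 \<noteq> 0"
proof -
  show "weyl g x 3 4 4 2 = 0"
    by (simp add: weyl_ef[OF xV] kulkarni_nomizu_def block_rows)
  show "cov_deriv g (weyl g) x 3 3 4 4 2 \<noteq> 0"
    using c r_nonzero[OF xV] sin_nonzero[OF xV]
    by (simp add: cov_deriv_weyl_ef[OF dc] kulkarni_nomizu_def drift_def axis_def block_rows)
qed

section \<open>Tensors compatible with the Weyl tensor\<close>

lemma raise_second_ef:
  "(\<Sum>d\<in>UNIV. raise_second g H x e d * ef_base A x $ f $ d) =
    (if f = 1 \<or> f = 2 then H x $ e $ f else 0)"
  "(\<Sum>d\<in>UNIV. raise_second g H x e d * ef_fibre x $ f $ d) =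
    (if f = 1 \<or> f = 2 then 0 else H x $ e $ f)"
  unfolding raise_second_def matrix_inv_ef_metric[OF xV] sum_4
  using exhaust_4[of f] r_nonzero[OF xV] sin_nonzero[OF xV]
  by (elim disjE; hypsubst; simp add: block_rows inverse_rows; (simp add: algebra_simps)?)+

lemma compatible_at_ef_iff:
  assumes c: "weyl_factor (x $ 1) (x $ 2) \<noteq> 0"
  shows "(\<forall>e f s t. cyclic_sum (\<lambda>e f s. \<Sum>d\<in>UNIV. raise_second g H x e d * weyl g x f s t d) e f s = 0)
    \<longleftrightarrow> H x $ 1 $ 2 = H x $ 2 $ 1 \<and> H x $ 3 $ 4 = H x $ 4 $ 3
      \<and> (\<forall>a\<in>{1, 2}. \<forall>b\<in>{3, 4}. H x $ a $ b = 0 \<and> H x $ b $ a = 0)"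
    (is "(\<forall>e f s t. ?lhs e f s t = 0) \<longleftrightarrow> ?block")
proof -
  define P Q where "P = ef_base A x" and "Q = ef_fibre x"
  \<comment> \<open>Contracting the raised index of H with P or Q projects the second index of H
    onto the (t,r) or the angular block; a and b are these two parts.\<close>
  define a b where "a e f = (if f = 1 \<or> f = 2 then H x $ e $ f else 0)"
    and "b e f = (if f = 1 \<or> f = 2 then 0 else H x $ e $ f)" for e f :: 4
  \<comment> \<open>The weight 2 comes from P \<and> P and Q \<and> Q, the weight -1 from - P \<and>
    Q.\<close>
  define p q where "p f s = (2 * a f s - b f s) - (2 * a s f - b s f)"
    and "q f s = (2 * b f s - a f s) - (2 * b s f - a s f)" for f s
  define L where "L e f s t = (P $ e $ t * p f s + P $ f $ t * p s e + P $ s $ t * p e f)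
    + (Q $ e $ t * q f s + Q $ f $ t * q s e + Q $ s $ t * q e f)" for e f s t
  have contract: "(\<Sum>d\<in>UNIV. raise_second g H x e d * weyl g x f s t d) =
    weyl_factor (x $ 1) (x $ 2) *
      ((2 * a e f - b e f) * P $ s $ t - (2 * a e s - b e s) * P $ f $ t
       + (2 * b e f - a e f) * Q $ s $ t - (2 * b e s - a e s) * Q $ f $ t)" for e f s t
    unfolding a_def b_def raise_second_ef[symmetric] weyl_ef[OF xV] P_def Q_def
      kulkarni_nomizu_def sum_4
    by (simp add: algebra_simps)
  have L: "?lhs e f s t = weyl_factor (x $ 1) (x $ 2) * L e f s t" for e f s t
    unfolding cyclic_sum_def contract L_def p_def q_def by (simp add: algebra_simps)
  show ?thesis
  proof
    assume "\<forall>e f s t. ?lhs e f s t = 0"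
    then have "?lhs e f s t = 0" for e f s t by blast
    then have L0: "L e f s t = 0" for e f s t
      using c unfolding L by simp
    \<comment> \<open>The two components isolate \<open>p 2 3\<close> and \<open>q 2 3\<close>, that
      is, - H23 - 2 H32 and 2 H23 + H32. These combinations are linearly independent, so both
      entries vanish.\<close>
    have "H x $ 2 $ 3 = 0 \<and> H x $ 3 $ 2 = 0"
      using L0[of 1 2 3 2] L0[of 2 3 4 4] sin_nonzero[OF xV] r_nonzero[OF xV]
      by (simp add: L_def P_def Q_def block_rows p_def q_def a_def b_def)
    moreover have "H x $ 2 $ 4 = 0 \<and> H x $ 4 $ 2 = 0"
      using L0[of 1 2 4 2] L0[of 2 3 4 3] r_nonzero[OF xV]
      by (simp add: L_def P_def Q_def block_rows p_def q_def a_def b_def)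
    \<comment> \<open>The components with indices 1 2 3 1 and 1 2 4 1 also contain the entry A of P,
      multiplied by \<open>p 2 3\<close> and \<open>p 2 4\<close>. Those are already zero, so the
      same argument applies to the first row and column. The last two components give the symmetry
      of the angular and of the (t,r) block.\<close>
    ultimately show ?block
      using L0[of 1 2 3 1] L0[of 1 2 4 1] L0[of 1 3 4 3] L0[of 1 3 4 4]
        L0[of 1 3 4 2] L0[of 1 2 3 3] r_nonzero[OF xV] sin_nonzero[OF xV]
      by (simp add: L_def P_def Q_def block_rows p_def q_def a_def b_def)
  next
    assume block: ?block
    then have zero: "H x $ 1 $ 3 = 0" "H x $ 1 $ 4 = 0" "H x $ 2 $ 3 = 0" "H x $ 2 $ 4 = 0"
      "H x $ 3 $ 1 = 0" "H x $ 4 $ 1 = 0" "H x $ 3 $ 2 = 0" "H x $ 4 $ 2 = 0" by auto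
    have "p f s = 0" and "q f s = 0" for f s
      using block exhaust_4[of f] exhaust_4[of s]
      by (elim disjE; hypsubst; simp add: p_def q_def a_def b_def zero)+
    then show "\<forall>e f s t. ?lhs e f s t = 0" by (simp add: L L_def)
  qed
qed

end

end

section \<open>The Vaidya-Bonner-de Sitter metric\<close>

definition vbds_lapse :: "(real \<Rightarrow> real) \<Rightarrow> (real \<Rightarrow> real) \<Rightarrow> real \<Rightarrow> real \<Rightarrow> real \<Rightarrow> real" where
  "vbds_lapse m q \<Lambda> t r = 1 - 2 * m t / r + (q t)\<^sup>2 / r\<^sup>2 - \<Lambda> * r\<^sup>2 / 3"

lemma vbds_metric_ef: "vbds_metric m q \<Lambda> = ef_metric (vbds_lapse m q \<Lambda>)"
  by (simp add: fun_eq_iff vbds_metric_def ef_metric_def vbds_lapse_def Let_def)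

lemma smooth_real_on_DERIV:
  assumes "smooth_real_on f T" "t \<in> T"
  shows "(f has_real_derivative deriv f t) (at t)"
proof -
  have "((deriv ^^ 0) f) differentiable (at t)"
    using assms unfolding smooth_real_on_def by blast
  then show ?thesis by (simp add: DERIV_deriv_iff_real_differentiable)
qed

locale vbds =
  fixes m q :: "real \<Rightarrow> real" and \<Lambda> :: real and T :: "real set"
  assumes T: "open T" and m: "smooth_real_on m T" and q: "smooth_real_on q T"
begin

sublocale ef_spacetime T "vbds_lapse m q \<Lambda>"
  "\<lambda>t r. - 2 * deriv m t / r + 2 * q t * deriv q t / r\<^sup>2"
  "\<lambda>t r. 2 * m t / r\<^sup>2 - 2 * (q t)\<^sup>2 / r ^ 3 - 2 * \<Lambda> * r / 3"
  "\<lambda>t r. 2 * deriv m t / r\<^sup>2 - 4 * q t * deriv q t / r ^ 3"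
  "\<lambda>t r. - 4 * m t / r ^ 3 + 6 * (q t)\<^sup>2 / r ^ 4 - 2 * \<Lambda> / 3"
proof
  show "open T" by (rule T)
  fix t r :: real
  assume t: "t \<in> T" and r: "0 < r"
  note dm = smooth_real_on_DERIV[OF m t] and dq = smooth_real_on_DERIV[OF q t]
  show "((\<lambda>s. vbds_lapse m q \<Lambda> s r) has_real_derivative
      - 2 * deriv m t / r + 2 * q t * deriv q t / r\<^sup>2) (at t)"
    unfolding vbds_lapse_def
    by (rule derivative_eq_intros dm dq refl | (use r in simp; fail))+
       (use r in \<open>simp add: field_simps eval_nat_numeral\<close>)
  show "(vbds_lapse m q \<Lambda> t has_real_derivative
      2 * m t / r\<^sup>2 - 2 * (q t)\<^sup>2 / r ^ 3 - 2 * \<Lambda> * r / 3) (at r)"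
    unfolding vbds_lapse_def [abs_def]
    by (rule derivative_eq_intros refl | (use r in simp; fail))+
       (use r in \<open>simp add: field_simps eval_nat_numeral\<close>)
  show "((\<lambda>r. - 2 * deriv m t / r + 2 * q t * deriv q t / r\<^sup>2) has_real_derivative
      2 * deriv m t / r\<^sup>2 - 4 * q t * deriv q t / r ^ 3) (at r)"
    by (rule derivative_eq_intros refl | (use r in simp; fail))+
       (use r in \<open>simp add: field_simps eval_nat_numeral\<close>)
  show "((\<lambda>s. 2 * m s / r\<^sup>2 - 2 * (q s)\<^sup>2 / r ^ 3 - 2 * \<Lambda> * r / 3) has_real_derivative
      2 * deriv m t / r\<^sup>2 - 4 * q t * deriv q t / r ^ 3) (at t)"
    by (rule derivative_eq_intros dm dq refl | (use r in simp; fail))+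
       (use r in \<open>simp add: field_simps eval_nat_numeral\<close>)
  show "((\<lambda>r. 2 * m t / r\<^sup>2 - 2 * (q t)\<^sup>2 / r ^ 3 - 2 * \<Lambda> * r / 3) has_real_derivative
      - 4 * m t / r ^ 3 + 6 * (q t)\<^sup>2 / r ^ 4 - 2 * \<Lambda> / 3) (at r)"
    by (rule derivative_eq_intros refl | (use r in simp; fail))+
       (use r in \<open>simp add: field_simps eval_nat_numeral\<close>)
qed

text \<open>On A = r^k the part of the numerator linear in A is -(k-1)(k-2) r^k. It kills the
  \<Lambda> term (k = 2), yields -2 on the constant 1, cancelling the explicit 2, and gives factors
  -6 and -12 on the mass and charge terms.\<close>

lemma weyl_factor_vbds: "weyl_factor t r = (r * m t - (q t)\<^sup>2) / r ^ 4"
proof (cases "r = 0")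
  case False
  then show ?thesis
    unfolding weyl_factor_def vbds_lapse_def by (simp add: field_simps eval_nat_numeral)
next
  \<comment> \<open>Both quotients have denominator 0 and hence value 0, so the formula can be
    rewritten without a side condition.\<close>
  case True
  show ?thesis unfolding weyl_factor_def True by simp
qed

text \<open>Stated as a derivative along the coordinate line, to yield both the partial
  differentiability and the value of the partial derivative.\<close>

lemma weyl_factor_vbds_derivative:
  assumes "x \<in> vbds_chart T"
  shows "((\<lambda>h. weyl_factor ((x + h *\<^sub>R axis i 1) $ 1) ((x + h *\<^sub>R axis i 1) $ 2)) has_real_derivative
    vector [(x $ 2 * deriv m (x $ 1) - 2 * q (x $ 1) * deriv q (x $ 1)) / x $ 2 ^ 4,
      (4 * (q (x $ 1))\<^sup>2 - 3 * x $ 2 * m (x $ 1)) / x $ 2 ^ 5, 0, 0] $ i) (at 0)"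
proof -
  have t: "x $ 1 \<in> T" and r: "0 < x $ 2" using assms by (auto simp: vbds_chart_def)
  note dm = smooth_real_on_DERIV[OF m t, THEN DERIV_at_0]
    and dq = smooth_real_on_DERIV[OF q t, THEN DERIV_at_0]
  have "((\<lambda>h. (x $ 2 * m (x $ 1 + h) - (q (x $ 1 + h))\<^sup>2) / x $ 2 ^ 4) has_real_derivative
      (x $ 2 * deriv m (x $ 1) - 2 * q (x $ 1) * deriv q (x $ 1)) / x $ 2 ^ 4) (at 0)"
    by (rule derivative_eq_intros dm dq refl | (use r in simp; fail))+
       (use r in \<open>simp add: field_simps eval_nat_numeral\<close>)
  moreover have "((\<lambda>h. ((x $ 2 + h) * m (x $ 1) - (q (x $ 1))\<^sup>2) / (x $ 2 + h) ^ 4) has_real_derivative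
      (4 * (q (x $ 1))\<^sup>2 - 3 * x $ 2 * m (x $ 1)) / x $ 2 ^ 5) (at 0)"
    by (rule derivative_eq_intros refl | (use r in simp; fail))+
       (use r in \<open>simp add: field_simps eval_nat_numeral\<close>)
  ultimately show ?thesis
    using exhaust_4[of i] unfolding weyl_factor_vbds
    by (elim disjE) (simp_all add: axis_def)
qed

lemma partial_deriv_weyl_factor_vbds:
  assumes "x \<in> vbds_chart T"
  shows "partial_deriv i (\<lambda>y. weyl_factor (y $ 1) (y $ 2)) x =
    vector [(x $ 2 * deriv m (x $ 1) - 2 * q (x $ 1) * deriv q (x $ 1)) / x $ 2 ^ 4,
      (4 * (q (x $ 1))\<^sup>2 - 3 * x $ 2 * m (x $ 1)) / x $ 2 ^ 5, 0, 0] $ i"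
  by (rule partial_deriv_eqI) (rule weyl_factor_vbds_derivative[OF assms])

end

section \<open>Recurrence and compatibility for the Vaidya-Bonner-de Sitter metric\<close>

theorem proposition3p3:
  fixes m q :: "real \<Rightarrow> real" and \<Lambda> :: real
    and T :: "real set" and U :: "(real ^ 4) set"
  assumes "open T" and "smooth_real_on m T" and "smooth_real_on q T"
    and "open U" and "U \<noteq> {}" and "U \<subseteq> vbds_chart T"
    and "\<And>x. x \<in> U \<Longrightarrow> (q (x $ 1))\<^sup>2 - x $ 2 * m (x $ 1) \<noteq> 0"
  shows "\<not> conformally_recurrent_on (vbds_metric m q \<Lambda>) U
    \<and> conformal_2forms_recurrent_on (vbds_metric m q \<Lambda>) U
        (\<lambda>x. let t = x $ 1; r = x $ 2 in
           vector
            [(r * deriv m t - deriv (\<lambda>t. (q t)\<^sup>2) t) / (r * m t - (q t)\<^sup>2),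
             (q t)\<^sup>2 / (r\<^sup>2 * m t - r * (q t)\<^sup>2),
             0, 0])
    \<and> (\<forall>H :: real ^ 4 \<Rightarrow> real ^ 4 ^ 4.
         compatible_on (vbds_metric m q \<Lambda>) U H (weyl (vbds_metric m q \<Lambda>)) \<longleftrightarrow>
         (\<exists>h11 h12 h22 h33 h34 h44 :: real ^ 4 \<Rightarrow> real. \<forall>x\<in>U.
            H x = vector
              [vector [h11 x, h12 x, 0, 0],
               vector [h12 x, h22 x, 0, 0],
               vector [0, 0, h33 x, h34 x],
               vector [0, 0, h34 x, h44 x]]))"
proof -
  interpret vbds m q \<Lambda> T using assms(1-3) by unfold_locales
  have V: "x \<in> vbds_chart T" if "x \<in> U" for x using assms(6) that by auto
  have c: "weyl_factor (x $ 1) (x $ 2) \<noteq> 0" if "x \<in> U" for x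
    using assms(7)[OF that] r_nonzero[OF V[OF that]] unfolding weyl_factor_vbds by simp
  have dc: "partially_differentiable_at i (\<lambda>y. weyl_factor (y $ 1) (y $ 2)) x" if "x \<in> U" for i x
    using weyl_factor_vbds_derivative[OF V[OF that]] unfolding partially_differentiable_at_def real_differentiable_def by blast
  have "\<not> conformally_recurrent_on (ef_metric (vbds_lapse m q \<Lambda>)) U"
  proof
    assume "conformally_recurrent_on (ef_metric (vbds_lapse m q \<Lambda>)) U"
    moreover obtain x where x: "x \<in> U" using assms(5) by blast
    ultimately obtain k where "cov_deriv (ef_metric (vbds_lapse m q \<Lambda>))
        (weyl (ef_metric (vbds_lapse m q \<Lambda>))) x 3 3 4 4 2
        = k * weyl (ef_metric (vbds_lapse m q \<Lambda>)) x 3 4 4 2"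
      unfolding conformally_recurrent_on_def by blast
    then show False
      using not_recurrent_at_ef[OF V[OF x] dc[OF x] c[OF x]] by simp
  qed
  moreover have "conformal_2forms_recurrent_on (ef_metric (vbds_lapse m q \<Lambda>)) U
        (\<lambda>x. let t = x $ 1; r = x $ 2 in
           vector
            [(r * deriv m t - deriv (\<lambda>t. (q t)\<^sup>2) t) / (r * m t - (q t)\<^sup>2),
             (q t)\<^sup>2 / (r\<^sup>2 * m t - r * (q t)\<^sup>2),
             0, 0])"
    unfolding conformal_2forms_recurrent_on_def
  proof (intro ballI allI cyclic_sum_cov_deriv_weyl_ef V dc, assumption+)
    fix x :: "real ^ 4" and i :: 4
    assume x: "x \<in> U"
    define t r where "t = x $ 1" and "r = x $ 2"
    have r: "r \<noteq> 0" and t: "t \<in> T" using V[OF x] by (auto simp: vbds_chart_def r_def t_def)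
    have nz: "r * m t - (q t)\<^sup>2 \<noteq> 0" using assms(7)[OF x] by (simp add: r_def t_def)
    have "r\<^sup>2 * m t - r * (q t)\<^sup>2 = r * (r * m t - (q t)\<^sup>2)"
      by (simp add: power2_eq_square algebra_simps)
    moreover have "deriv (\<lambda>t. (q t)\<^sup>2) t = 2 * q t * deriv q t"
      by (rule DERIV_imp_deriv)
         (rule derivative_eq_intros smooth_real_on_DERIV[OF q t] refl | simp)+
    \<comment> \<open>The r component is the identity (4 q^2 - 3 r m)/r^5 + 3 (r m - q^2)/r^5 =
      q^2/r^5; in the t component dr contributes nothing.\<close>
    ultimately show "weyl_factor (x $ 1) (x $ 2) * (let t = x $ 1; r = x $ 2 in
        vector
          [(r * deriv m t - deriv (\<lambda>t. (q t)\<^sup>2) t) / (r * m t - (q t)\<^sup>2),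
           (q t)\<^sup>2 / (r\<^sup>2 * m t - r * (q t)\<^sup>2),
           0, 0]) $ i =
        partial_deriv i (\<lambda>y. weyl_factor (y $ 1) (y $ 2)) x
          + weyl_factor (x $ 1) (x $ 2) * (3 / x $ 2) * axis 2 1 $ i"
      using exhaust_4[of i] r nz
      unfolding partial_deriv_weyl_factor_vbds[OF V[OF x]]
      unfolding weyl_factor_vbds Let_def
        t_def[symmetric] r_def[symmetric]
      by (elim disjE; hypsubst; simp add: axis_def; (simp add: divide_simps)?;
          (simp add: algebra_simps eval_nat_numeral)?)
  qed
  moreover have "compatible_on (ef_metric (vbds_lapse m q \<Lambda>)) U H
        (weyl (ef_metric (vbds_lapse m q \<Lambda>))) \<longleftrightarrow>
      (\<exists>h11 h12 h22 h33 h34 h44 :: real ^ 4 \<Rightarrow> real. \<forall>x\<in>U.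
            H x = vector
              [vector [h11 x, h12 x, 0, 0],
               vector [h12 x, h22 x, 0, 0],
               vector [0, 0, h33 x, h34 x],
               vector [0, 0, h34 x, h44 x]])" (is "?compatible \<longleftrightarrow> ?form")
    for H :: "real ^ 4 \<Rightarrow> real ^ 4 ^ 4"
  proof -
    have "?compatible \<longleftrightarrow> (\<forall>x\<in>U. H x $ 1 $ 2 = H x $ 2 $ 1 \<and> H x $ 3 $ 4 = H x $ 4 $ 3
      \<and> (\<forall>a\<in>{1, 2}. \<forall>b\<in>{3, 4}. H x $ a $ b = 0 \<and> H x $ b $ a = 0))"
      unfolding compatible_on_def by (intro ball_cong refl compatible_at_ef_iff V c)
    also have "\<dots> \<longleftrightarrow> ?form"
    proof
      assume "\<forall>x\<in>U. H x $ 1 $ 2 = H x $ 2 $ 1 \<and> H x $ 3 $ 4 = H x $ 4 $ 3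
        \<and> (\<forall>a\<in>{1, 2}. \<forall>b\<in>{3, 4}. H x $ a $ b = 0 \<and> H x $ b $ a = 0)"
      then have "H x = vector
          [vector [H x $ 1 $ 1, H x $ 1 $ 2, 0, 0],
           vector [H x $ 1 $ 2, H x $ 2 $ 2, 0, 0],
           vector [0, 0, H x $ 3 $ 3, H x $ 3 $ 4],
           vector [0, 0, H x $ 3 $ 4, H x $ 4 $ 4]]" if "x \<in> U" for x
        using that by (simp add: vec_eq_iff forall_4)
      then show ?form by (intro exI ballI)
    next
      assume ?form
      then obtain h11 h12 h22 h33 h34 h44 where H: "H x = vector
          [vector [h11 x, h12 x, 0, 0], vector [h12 x, h22 x, 0, 0],
           vector [0, 0, h33 x, h34 x], vector [0, 0, h34 x, h44 x]]" if "x \<in> U" for x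
        by metis
      show "\<forall>x\<in>U. H x $ 1 $ 2 = H x $ 2 $ 1 \<and> H x $ 3 $ 4 = H x $ 4 $ 3
        \<and> (\<forall>a\<in>{1, 2}. \<forall>b\<in>{3, 4}. H x $ a $ b = 0 \<and> H x $ b $ a = 0)"
        by (intro ballI conjI) (auto simp: H)
    qed
    finally show ?thesis .
  qed
  ultimately show ?thesis unfolding vbds_metric_ef by blast
qed

end
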